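(* Let $\mathbf K$ be a field, $n\ge 1$, and let $\mathcal A^n$ be an $n$-dimensional $\mathbf K$-vector space with basis $\{e^i\}_{i=1}^n$. For a family $W=(W^{ij}_k)_{1\le i,j,k\le n}$ of elements of $\mathbf K$, let $\mathcal A^n_W$ denote $\mathcal A^n$ equipped with the bilinear product determined by $$e^i*e^j=\sum_{s=1}^n W^{ij}_s\,e^s .$$ Then: (1) The assignment $W\mapsto \mathcal A^n_W$ is a one-to-one correspondence between the universal extension tensors $W$ (equivalently, the $n$-dimensional universal extensions $\mathcal G^n_W$ over $\mathbf K$ defined by the tensors $W^{ij}_k$) and the $n$-dimensional associative commutative algebras over $\mathbf K$ (with chosen basis $\{e^i\}$, i.e. the associative commutative bilinear products on $\mathcal A^n$). (2) For every universal extension tensor $W$, the linear map $\mathcal A^n_W\to \mathrm{Mat}(n,\mathbf K)$ determined by $e^i\mapsto W^{(i)}$, where $(W^{(i)})^j_k=W^{ij}_k$, is a matrix representation of the algebra $\mathcal A^n_W$. Moreover, under a nonsingular linear transformation of the basis $$e^{i'}=\sum_{i=1}^n A^{i'}_i\,e^i ,$$ the tensor $W$ and the matrices $W^{(i)}$ transform by $$W^{i'j'}_{k'}=\sum_{i,j,k=1}^n A^{i'}_iA^{j'}_jA^{k}_{k'}W^{ij}_k,\qquad W^{(i')}=\sum_{i=1}^n \left(A^{-1}W^{(i)}A\right)A^{i'}_i ,$$ where $W^{i'j'}_{k'}$ are the structure constants in the new basis, $e^{i'}*e^{j'}=\sum_{k'}W^{i'j'}_{k'}e^{k'}$, and $(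W^{(i')})^{j'}_{k'}=W^{i'j'}_{k'}$.
   Context: Universal extensions: for a Lie algebra $\mathcal G$ over $\mathbf K$, let $\mathcal G^n$ be the vector space of $n$-tuples $\mathbf x=(x_1,\dots,x_n)$, $x_i\in\mathcal G$. A family $W=(W^{ij}_s)_{1\le i,j,s\le n}$ of elements of $\mathbf K$ is called a universal extension tensor if, for every Lie algebra $\mathcal G$ over $\mathbf K$ (with the same $W$), the formula $$([\mathbf x,\mathbf y]_W)_s=\sum_{i,j=1}^n W^{ij}_s[x_i,y_j],\qquad 1\le s\le n,$$ defines a Lie bracket on $\mathcal G^n$. The resulting Lie algebra is denoted $\mathcal G^n_W$ and is called an ($n$-dimensional) universal extension. Algebras are not required to have a unit. A matrix representation of an algebra $\mathcal A$ is a $\mathbf K$-linear map $\Phi:\mathcal A\to \mathrm{Mat}(m,\mathbf K)$ with $\Phi(x*y)=\Phi(x)\Phi(y)$ for all $x,y\in\mathcal A$ ($\mathrm{Mat}(m,\mathbf K)$ being an associative algebra under matrix multiplication). Index conventions: in a matrix with an upper and a lower index, such as $(W^{(i)})^j_k$ or $A=(A_i^{i'})$, the lower index is the row index and the upper index is the column index for $W^{(i)}$ and $A$. The numbers $A^k_{k'}$ are the entries of the inverse matrix $A^{-1}$ (row $k'$, column $k$), so that $\sum_{k'}A_k^{k'}A_{k'}^s=\delta_k^s$. *)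

theory Defs
  imports "HOL-Analysis.Analysis" "HOL-Library.Poly_Mapping"
begin

section \<open>Lie algebras and universal extensions\<close>

text \<open>
  A Lie algebra is a linear subspace \<open>V\<close> of an ambient vector space with a bracket that is only
  constrained on \<open>V\<close>, so that one ambient type carries Lie algebras of different dimensions.
  The bracket is alternating, which in characteristic 2 is stronger than antisymmetric.
\<close>

definition lie_algebra_on ::
  "('k::field \<Rightarrow> 'g::ab_group_add \<Rightarrow> 'g) \<Rightarrow> 'g set \<Rightarrow> ('g \<Rightarrow> 'g \<Rightarrow> 'g) \<Rightarrow> bool" where
  "lie_algebra_on smul V br \<longleftrightarrow>
     vector_space smul \<and> module.subspace smul V \<and>
     (\<forall>x\<in>V. \<forall>y\<in>V. br x y \<in> V) \<and>
     (\<forall>x\<in>V. \<forall>y\<in>V. \<forall>z\<in>V. br (x + y) z = br x z + br y z \<and> br x (y + z) = br x y + br x z) \<and>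
     (\<forall>c. \<forall>x\<in>V. \<forall>y\<in>V. br (smul c x) y = smul c (br x y) \<and> br x (smul c y) = smul c (br x y)) \<and>
     (\<forall>x\<in>V. br x x = 0) \<and>
     (\<forall>x\<in>V. \<forall>y\<in>V. \<forall>z\<in>V. br (br x y) z + br (br y z) x + br (br z x) y = 0)"

definition tuples :: "'g set \<Rightarrow> ('g ^ 'n) set" where
  "tuples V = {x. \<forall>i. x $ i \<in> V}"

definition tuple_scale :: "('k \<Rightarrow> 'g \<Rightarrow> 'g) \<Rightarrow> 'k \<Rightarrow> 'g ^ 'n \<Rightarrow> 'g ^ 'n" where
  "tuple_scale smul c x = (\<chi> i. smul c (x $ i))"

text \<open>Here and below \<open>W i j s\<close> stands for the entry of \<open>W\<close> with upper indices \<open>i\<close>, \<open>j\<close> and lower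
  index \<open>s\<close>.\<close>

definition extension_bracket ::
  "('n \<Rightarrow> 'n \<Rightarrow> 'n \<Rightarrow> 'k) \<Rightarrow> ('k \<Rightarrow> 'g::ab_group_add \<Rightarrow> 'g) \<Rightarrow> ('g \<Rightarrow> 'g \<Rightarrow> 'g) \<Rightarrow>
   'g ^ 'n::finite \<Rightarrow> 'g ^ 'n \<Rightarrow> 'g ^ 'n" where
  "extension_bracket W smul br x y =
     (\<chi> s. \<Sum>i\<in>UNIV. \<Sum>j\<in>UNIV. smul (W i j s) (br (x $ i) (y $ j)))"

definition universal_extension_tensor_in ::
  "'g::ab_group_add itself \<Rightarrow> ('n::finite \<Rightarrow> 'n \<Rightarrow> 'n \<Rightarrow> 'k::field) \<Rightarrow> bool" where
  "universal_extension_tensor_in _ W \<longleftrightarrow>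
     (\<forall>(smul :: 'k \<Rightarrow> 'g \<Rightarrow> 'g) V br. lie_algebra_on smul V br \<longrightarrow>
        lie_algebra_on (tuple_scale smul) (tuples V :: ('g ^ 'n) set) (extension_bracket W smul br))"

text \<open>
  A HOL formula cannot quantify over types, so the Lie algebras in the definition of a universal
  extension tensor are those living inside one ambient type. The type \<open>nat \<Rightarrow>\<^sub>0 'k\<close> of finitely
  supported sequences contains a copy of every Lie algebra of countable dimension. This
  loses nothing: a violation of one of the axioms involves at most three \<open>n\<close>-tuples, and the
  subalgebra generated by their entries has countable dimension.
\<close>

definition universal_extension_tensor :: "('n::finite \<Rightarrow> 'n \<Rightarrow> 'n \<Rightarrow> 'k::field) \<Rightarrow> bool" where
  "universal_extension_tensor W \<longleftrightarrow> universal_extension_tensor_in TYPE(nat \<Rightarrow>\<^sub>0 'k) W"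

text \<open>
  The universal extension defined by \<open>W\<close>, as the operation that takes a Lie algebra (a scalar
  multiplication, a carrier and a bracket) to the bracket on \<open>n\<close>-tuples. The
  restrictions discard the values outside the domains, so that equality of two universal
  extensions means equality of the brackets for every Lie algebra.
\<close>

definition universal_extension ::
  "('n::finite \<Rightarrow> 'n \<Rightarrow> 'n \<Rightarrow> 'k::field) \<Rightarrow>
   ('k \<Rightarrow> (nat \<Rightarrow>\<^sub>0 'k) \<Rightarrow> (nat \<Rightarrow>\<^sub>0 'k)) \<times> (nat \<Rightarrow>\<^sub>0 'k) set \<times>
     ((nat \<Rightarrow>\<^sub>0 'k) \<Rightarrow> (nat \<Rightarrow>\<^sub>0 'k) \<Rightarrow> (nat \<Rightarrow>\<^sub>0 'k)) \<Rightarrow>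
   (nat \<Rightarrow>\<^sub>0 'k) ^ 'n \<Rightarrow> (nat \<Rightarrow>\<^sub>0 'k) ^ 'n \<Rightarrow> (nat \<Rightarrow>\<^sub>0 'k) ^ 'n" where
  "universal_extension W =
     (\<lambda>(smul, V, br) \<in> {(smul, V, br). lie_algebra_on smul V br}.
        \<lambda>x \<in> tuples V. \<lambda>y \<in> tuples V. extension_bracket W smul br x y)"

section \<open>Algebras given by structure constants\<close>

definition indexed_basis ::
  "('k::field \<Rightarrow> 'a::ab_group_add \<Rightarrow> 'a) \<Rightarrow> ('n::finite \<Rightarrow> 'a) \<Rightarrow> bool" where
  "indexed_basis smul e \<longleftrightarrow> inj e \<and> finite_dimensional_vector_space smul (range e)"

definition bilinear_product ::
  "('k::field \<Rightarrow> 'a::ab_group_add \<Rightarrow> 'a) \<Rightarrow> ('a \<Rightarrow> 'a \<Rightarrow> 'a) \<Rightarrow> bool" where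
  "bilinear_product smul m \<longleftrightarrow>
     (\<forall>x. Vector_Spaces.linear smul smul (\<lambda>y. m x y)) \<and>
     (\<forall>y. Vector_Spaces.linear smul smul (\<lambda>x. m x y))"

definition assoc_comm_product ::
  "('k::field \<Rightarrow> 'a::ab_group_add \<Rightarrow> 'a) \<Rightarrow> ('a \<Rightarrow> 'a \<Rightarrow> 'a) \<Rightarrow> bool" where
  "assoc_comm_product smul m \<longleftrightarrow>
     bilinear_product smul m \<and> (\<forall>x y z. m (m x y) z = m x (m y z)) \<and> (\<forall>x y. m x y = m y x)"

definition structure_constants ::
  "('k::field \<Rightarrow> 'a::ab_group_add \<Rightarrow> 'a) \<Rightarrow> ('n::finite \<Rightarrow> 'a) \<Rightarrow> ('a \<Rightarrow> 'a \<Rightarrow> 'a) \<Rightarrow>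
   ('n \<Rightarrow> 'n \<Rightarrow> 'n \<Rightarrow> 'k) \<Rightarrow> bool" where
  "structure_constants smul e m W \<longleftrightarrow>
     (\<forall>i j. m (e i) (e j) = (\<Sum>s\<in>UNIV. smul (W i j s) (e s)))"

definition algebra_product ::
  "('k::field \<Rightarrow> 'a::ab_group_add \<Rightarrow> 'a) \<Rightarrow> ('n::finite \<Rightarrow> 'a) \<Rightarrow> ('n \<Rightarrow> 'n \<Rightarrow> 'n \<Rightarrow> 'k) \<Rightarrow>
   'a \<Rightarrow> 'a \<Rightarrow> 'a" where
  "algebra_product smul e W =
     (THE m. bilinear_product smul m \<and> structure_constants smul e m W)"

lemma linear_eq_on_indexed_basis:
  assumes e: "indexed_basis s1 e"
    and f: "Vector_Spaces.linear s1 s2 f" and g: "Vector_Spaces.linear s1 s2 g"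
    and fg: "\<And>i. f (e i) = g (e i)"
  shows "f = g"
proof
  fix x
  interpret finite_dimensional_vector_space s1 "range e"
    using e by (simp add: indexed_basis_def)
  interpret f: Vector_Spaces.linear s1 s2 f by (fact f)
  interpret vector_space_pair s1 s2 by unfold_locales
  show "f x = g x"
    by (rule linear_eq_on[OF f g, where B = "range e"]) (auto simp: fg span_Basis)
qed

lemma ex1_bilinear_product:
  fixes W :: "'n::finite \<Rightarrow> 'n \<Rightarrow> 'n \<Rightarrow> 'k::field" and smul :: "'k \<Rightarrow> 'a::ab_group_add \<Rightarrow> 'a"
  assumes e: "indexed_basis smul e"
  shows "\<exists>!m. bilinear_product smul m \<and> structure_constants smul e m W"
proof -
  interpret finite_dimensional_vector_space smul "range e"
    using e by (simp add: indexed_basis_def)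
  have inj: "inj e" using e by (simp add: indexed_basis_def)
  have vs: "vector_space smul" by unfold_locales
  let ?r = "representation (range e)"
  let ?p = "\<lambda>i j. \<Sum>s\<in>UNIV. smul (W i j s) (e s)"
  define m where "m x y = (\<Sum>i\<in>UNIV. \<Sum>j\<in>UNIV. smul (?r x (e i) * ?r y (e j)) (?p i j))" for x y
  have add: "?r (x + y) b = ?r x b + ?r y b" and mul: "?r (smul c x) b = c * ?r x b" for x y c b
    by (simp_all add: representation_add representation_scale independent_Basis span_Basis)
  have r: "?r (e i) (e j) = (if i = j then 1 else 0)" for i j
    using inj by (auto simp: representation_basis independent_Basis inj_eq)
  have "bilinear_product smul m"
    unfolding bilinear_product_def Vector_Spaces.linear_iff
    by (simp add: vs m_def add mul scale_left_distrib scale_sum_right sum.distrib algebra_simps)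
  moreover have "structure_constants smul e m W"
    unfolding structure_constants_def
  proof (intro allI)
    fix a b
    have "m (e a) (e b) = (\<Sum>i\<in>UNIV. \<Sum>j\<in>UNIV. if b = j then if a = i then ?p i j else 0 else 0)"
      unfolding m_def r by (intro sum.cong) auto
    also have "\<dots> = ?p a b"
      by simp
    finally show "m (e a) (e b) = ?p a b" .
  qed
  moreover have "m1 = m2"
    if "bilinear_product smul m1 \<and> structure_constants smul e m1 W"
      and "bilinear_product smul m2 \<and> structure_constants smul e m2 W" for m1 m2
  proof -
    have "(\<lambda>x. m1 x (e j)) = (\<lambda>x. m2 x (e j))" for j
      by (rule linear_eq_on_indexed_basis[OF e])
        (use that in \<open>auto simp: bilinear_product_def structure_constants_def\<close>)
    then have "m1 x = m2 x" for x
      by (intro linear_eq_on_indexed_basis[OF e])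
        (use that in \<open>auto simp: bilinear_product_def dest: fun_cong\<close>)
    then show ?thesis by auto
  qed
  ultimately show ?thesis by blast
qed

lemma algebra_product:
  assumes "indexed_basis smul e"
  shows "bilinear_product smul (algebra_product smul e W)"
    and "structure_constants smul e (algebra_product smul e W) W"
  using theI'[OF ex1_bilinear_product[OF assms, of W]] by (simp_all add: algebra_product_def)

section \<open>Matrix representations\<close>

definition matrix_scale :: "'k::field \<Rightarrow> 'k ^ 'n ^ 'm \<Rightarrow> 'k ^ 'n ^ 'm" where
  "matrix_scale c M = (\<chi> r s. c * M $ r $ s)"

definition matrix_representation ::
  "('k::field \<Rightarrow> 'a::ab_group_add \<Rightarrow> 'a) \<Rightarrow> ('a \<Rightarrow> 'a \<Rightarrow> 'a) \<Rightarrow> ('a \<Rightarrow> 'k ^ 'm::finite ^ 'm) \<Rightarrow> bool" where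
  "matrix_representation smul m \<Phi> \<longleftrightarrow>
     Vector_Spaces.linear smul matrix_scale \<Phi> \<and> (\<forall>x y. \<Phi> (m x y) = \<Phi> x ** \<Phi> y)"

text \<open>The lower index \<open>k\<close> is the row and the upper index \<open>j\<close> the column.\<close>

definition tensor_matrix :: "('n \<Rightarrow> 'n \<Rightarrow> 'n \<Rightarrow> 'k) \<Rightarrow> 'n \<Rightarrow> 'k ^ 'n::finite ^ 'n" where
  "tensor_matrix W i = (\<chi> k j. W i j k)"

text \<open>The row of \<open>A\<close> is the index of the old basis and the column the index of the new one.\<close>

definition change_basis ::
  "('k::field \<Rightarrow> 'a::ab_group_add \<Rightarrow> 'a) \<Rightarrow> 'k ^ 'n ^ 'n \<Rightarrow> ('n::finite \<Rightarrow> 'a) \<Rightarrow> 'n \<Rightarrow> 'a" where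
  "change_basis smul A e i' = (\<Sum>i\<in>UNIV. smul (A $ i $ i') (e i))"

end

theory Submission
  imports Defs
begin

text \<open>
  Being a universal extension tensor is equivalent to the symmetry of \<open>W\<close> in its upper indices
  together with the associativity of the product it defines. For such \<open>W\<close> the coefficient of
  \<open>[[x\<^sub>i, y\<^sub>j], z\<^sub>k]\<close> in the double bracket is invariant under permutations of \<open>i\<close>, \<open>j\<close>, \<open>k\<close>,
  so that the Jacobi identity follows termwise. For the converse, the two-dimensional Lie algebra
  \<open>[a, b] = a\<close> suffices: the double brackets of \<open>a\<close>, \<open>b\<close>, \<open>b\<close> are \<open>[[a, b], b] = a\<close>,
  \<open>[[b, b], a] = 0\<close> and \<open>[[b, a], b] = -a\<close>, and comparing their coefficients in
  the Jacobi identity of the extension gives the associativity. The matrices \<open>W\<^sup>(\<^sup>i\<^sup>)\<close> are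
  those of the multiplication operators, so that associativity makes them a representation.
\<close>

section \<open>Lie brackets from symmetric associative tensors\<close>

definition assoc_comm_tensor :: "('n::finite \<Rightarrow> 'n \<Rightarrow> 'n \<Rightarrow> 'k::field) \<Rightarrow> bool" where
  "assoc_comm_tensor W \<longleftrightarrow>
     (\<forall>i j s. W i j s = W j i s) \<and>
     (\<forall>i j k t. (\<Sum>s\<in>UNIV. W i j s * W s k t) = (\<Sum>s\<in>UNIV. W j k s * W i s t))"

text \<open>Off-diagonal terms cancel in pairs. The diagonal has its own assumption because in
  characteristic 2 the pair condition at \<open>i = j\<close> says nothing about
  \<open>f i i\<close>.\<close>

lemma sum_alternating_eq_0:
  fixes f :: "'i \<Rightarrow> 'i \<Rightarrow> 'b::ab_group_add"
  assumes "finite S" and "\<And>i. f i i = 0" and "\<And>i j. f i j + f j i = 0"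
  shows "(\<Sum>i\<in>S. \<Sum>j\<in>S. f i j) = 0"
  using assms(1)
proof induction
  case (insert a S)
  have "(\<Sum>i\<in>insert a S. \<Sum>j\<in>insert a S. f i j) =
      f a a + (\<Sum>i\<in>S. f a i + f i a) + (\<Sum>i\<in>S. \<Sum>j\<in>S. f i j)"
    using insert.hyps by (simp add: sum.distrib algebra_simps)
  then show ?case
    using insert.IH assms by simp
qed simp

text \<open>\<open>br\<close> is linear only on \<open>V\<close>, so the induction has to keep every
  partial sum inside \<open>V\<close>. The fact \<open>zero\<close> serves both empty and infinite
  \<open>I\<close>, where the sums are 0.\<close>

lemma bracket_sum_left:
  assumes "lie_algebra_on smul V br"
    and "\<And>i. i \<in> I \<Longrightarrow> x i \<in> V" and "y \<in> V"
  shows "br (\<Sum>i\<in>I. smul (c i) (x i)) y = (\<Sum>i\<in>I. smul (c i) (br (x i) y))"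
proof -
  interpret vector_space smul
    using assms(1) by (simp add: lie_algebra_on_def)
  have V: "subspace V"
    using assms(1) by (simp add: lie_algebra_on_def)
  have scale: "br (smul c u) y = smul c (br u y)" if "u \<in> V" for c u
    using assms(1,3) that by (simp add: lie_algebra_on_def)
  have add: "br (u + v) y = br u y + br v y" if "u \<in> V" "v \<in> V" for u v
    using assms(1,3) that unfolding lie_algebra_on_def by blast
  have zero: "br 0 y = 0"
    using scale[of 0 0] subspace_0[OF V] by simp
  show ?thesis
    using assms(2)
  proof (induction I rule: infinite_finite_induct)
    case (insert a I)
    then show ?case
      by (simp add: add scale V subspace_sum subspace_scale)
  qed (simp_all add: zero)
qed

text \<open>Polarisation of \<open>br u u = 0\<close> at \<open>u = x + y\<close>.\<close>

lemma bracket_antisym: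
  assumes "lie_algebra_on smul V br" and "x \<in> V" and "y \<in> V"
  shows "br x y + br y x = 0"
proof -
  interpret vector_space smul
    using assms(1) by (simp add: lie_algebra_on_def)
  have "x + y \<in> V"
    using assms subspace_add by (simp add: lie_algebra_on_def)
  then have "0 = br (x + y) (x + y)"
    using assms(1) by (simp add: lie_algebra_on_def)
  also have "\<dots> = br x x + br x y + (br y x + br y y)"
    using assms \<open>x + y \<in> V\<close> unfolding lie_algebra_on_def by metis
  also have "\<dots> = br x y + br y x"
    using assms by (simp add: lie_algebra_on_def)
  finally show ?thesis by simp
qed

lemma extension_bracket_in_tuples:
  assumes L: "lie_algebra_on smul V br" and "x \<in> tuples V" and "y \<in> tuples V"
  shows "extension_bracket W smul br x y \<in> tuples V"
proof -
  interpret vector_space smul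
    using assms(1) by (simp add: lie_algebra_on_def)
  show ?thesis
    using assms
    by (auto simp: tuples_def extension_bracket_def lie_algebra_on_def
        intro!: subspace_sum subspace_scale)
qed

text \<open>All dependence on \<open>W\<close> is collected in one scalar per triple of indices, the
  coefficient of e^t in (e^i * e^j) * e^k. The Jacobi identity of the extension can then be compared
  with that of \<open>br\<close> term by term.\<close>

lemma extension_bracket_triple:
  assumes L: "lie_algebra_on smul V br"
    and x: "x \<in> tuples V" and y: "y \<in> tuples V" and z: "z \<in> tuples V"
  shows "extension_bracket W smul br (extension_bracket W smul br x y) z $ t =
    (\<Sum>i\<in>UNIV. \<Sum>j\<in>UNIV. \<Sum>k\<in>UNIV.
       smul (\<Sum>s\<in>UNIV. W i j s * W s k t) (br (br (x $ i) (y $ j)) (z $ k)))"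
proof -
  interpret vector_space smul
    using L by (simp add: lie_algebra_on_def)
  have V: "subspace V" and brV: "\<And>u v. u \<in> V \<Longrightarrow> v \<in> V \<Longrightarrow> br u v \<in> V"
    using L by (simp_all add: lie_algebra_on_def)
  have xV: "x $ i \<in> V" and yV: "y $ i \<in> V" and zV: "z $ i \<in> V" for i
    using x y z by (simp_all add: tuples_def)
  let ?f = "\<lambda>i j k. br (br (x $ i) (y $ j)) (z $ k)"
  have *: "br (\<Sum>i\<in>UNIV. \<Sum>j\<in>UNIV. smul (W i j s) (br (x $ i) (y $ j))) (z $ k) =
    (\<Sum>i\<in>UNIV. \<Sum>j\<in>UNIV. smul (W i j s) (?f i j k))" for s k
  proof -
    \<comment> \<open>\<open>bracket_sum_left\<close> expects scaled summands, hence the dummy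
      factor 1 in the outer sum.\<close>
    have "br (\<Sum>i\<in>UNIV. smul 1 (\<Sum>j\<in>UNIV. smul (W i j s) (br (x $ i) (y $ j)))) (z $ k) =
      (\<Sum>i\<in>UNIV. smul 1 (br (\<Sum>j\<in>UNIV. smul (W i j s) (br (x $ i) (y $ j))) (z $ k)))"
      by (rule bracket_sum_left[OF L]) (auto intro!: subspace_sum subspace_scale V brV xV yV zV)
    also have "\<dots> = (\<Sum>i\<in>UNIV. \<Sum>j\<in>UNIV. smul (W i j s) (?f i j k))"
      by (simp add: bracket_sum_left[OF L] brV xV yV zV)
    finally show ?thesis by simp
  qed
  have "extension_bracket W smul br (extension_bracket W smul br x y) z $ t =
    (\<Sum>s\<in>UNIV. \<Sum>k\<in>UNIV. \<Sum>i\<in>UNIV. \<Sum>j\<in>UNIV. smul (W i j s * W s k t) (?f i j k))"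
    by (simp add: extension_bracket_def * scale_sum_right mult.commute)
  \<comment> \<open>Neighbouring sums are exchanged until \<open>s\<close> is innermost, where it
    affects only the scalar.\<close>
  also have "\<dots> = (\<Sum>k\<in>UNIV. \<Sum>s\<in>UNIV. \<Sum>i\<in>UNIV. \<Sum>j\<in>UNIV. smul (W i j s * W s k t) (?f i j k))"
    by (rule sum.swap)
  also have "\<dots> = (\<Sum>k\<in>UNIV. \<Sum>i\<in>UNIV. \<Sum>s\<in>UNIV. \<Sum>j\<in>UNIV. smul (W i j s * W s k t) (?f i j k))"
    by (intro sum.cong refl sum.swap)
  also have "\<dots> = (\<Sum>k\<in>UNIV. \<Sum>i\<in>UNIV. \<Sum>j\<in>UNIV. \<Sum>s\<in>UNIV. smul (W i j s * W s k t) (?f i j k))"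
    by (intro sum.cong refl sum.swap)
  also have "\<dots> = (\<Sum>i\<in>UNIV. \<Sum>k\<in>UNIV. \<Sum>j\<in>UNIV. \<Sum>s\<in>UNIV. smul (W i j s * W s k t) (?f i j k))"
    by (rule sum.swap)
  also have "\<dots> = (\<Sum>i\<in>UNIV. \<Sum>j\<in>UNIV. \<Sum>k\<in>UNIV. \<Sum>s\<in>UNIV. smul (W i j s * W s k t) (?f i j k))"
    by (intro sum.cong refl sum.swap)
  finally show ?thesis
    by (simp add: scale_sum_left)
qed

text \<open>In terms of the product, (e^j * e^k) * e^i = e^i * (e^j * e^k) = (e^i * e^j) * e^k, read
  off at e^t. This cyclic invariance is what the Jacobi identity uses.\<close>

lemma assoc_comm_tensor_rotate:
  assumes "assoc_comm_tensor W"
  shows "(\<Sum>s\<in>UNIV. W j k s * W s i t) = (\<Sum>s\<in>UNIV. W i j s * W s k t)"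
proof -
  have sym: "W i j s = W j i s" for i j s
    using assms unfolding assoc_comm_tensor_def by blast
  have assoc: "(\<Sum>s\<in>UNIV. W i j s * W s k t) = (\<Sum>s\<in>UNIV. W j k s * W i s t)" for i j k t
    using assms unfolding assoc_comm_tensor_def by blast
  show ?thesis
    unfolding assoc[of i j k t] by (simp only: sym[of _ i])
qed

lemma vector_space_tuple_scale:
  assumes "vector_space smul"
  shows "vector_space (tuple_scale smul :: _ \<Rightarrow> _ ^ 'n \<Rightarrow> _)"
proof -
  interpret vector_space smul by fact
  show ?thesis
    by unfold_locales (simp_all add: tuple_scale_def vec_eq_iff algebra_simps)
qed

lemma lie_algebra_on_extension:
  fixes W :: "'n::finite \<Rightarrow> 'n \<Rightarrow> 'n \<Rightarrow> 'k::field"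
  assumes W: "assoc_comm_tensor W" and L: "lie_algebra_on smul V br"
  shows "lie_algebra_on (tuple_scale smul) (tuples V) (extension_bracket W smul br)"
proof -
  let ?E = "extension_bracket W smul br"
  interpret vector_space smul
    using L by (simp add: lie_algebra_on_def)
  interpret T: vector_space "tuple_scale smul :: _ \<Rightarrow> _ ^ 'n \<Rightarrow> _"
    by (rule vector_space_tuple_scale) unfold_locales
  have V: "subspace V" and brV: "\<And>u v. u \<in> V \<Longrightarrow> v \<in> V \<Longrightarrow> br u v \<in> V"
    using L by (simp_all add: lie_algebra_on_def)
  have scale: "br (smul c u) v = smul c (br u v)" "br u (smul c v) = smul c (br u v)"
    if "u \<in> V" "v \<in> V" for c u v
    using L that by (simp_all add: lie_algebra_on_def)
  have add: "br (u + u') v = br u v + br u' v" "br v (u + u') = br v u + br v u'"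
    if "u \<in> V" "u' \<in> V" "v \<in> V" for u u' v
    using L that unfolding lie_algebra_on_def by blast+
  have sub: "T.subspace (tuples V)"
    using V by (auto simp: T.subspace_def subspace_def tuples_def tuple_scale_def)
  have sym: "W i j s = W j i s" for i j s
    using W unfolding assoc_comm_tensor_def by blast
  have alt: "?E x x = 0" if x: "x \<in> tuples V" for x
  proof -
    \<comment> \<open>Symmetry of \<open>W\<close> passes the antisymmetry of \<open>br\<close> on
      to the summands; the diagonal vanishes because \<open>br\<close> is alternating.\<close>
    have "(\<Sum>i\<in>UNIV. \<Sum>j\<in>UNIV. smul (W i j s) (br (x $ i) (x $ j))) = 0" for s
    proof (rule sum_alternating_eq_0)
      show "smul (W i i s) (br (x $ i) (x $ i)) = 0" for i
        using L x by (simp add: lie_algebra_on_def tuples_def)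
      show "smul (W i j s) (br (x $ i) (x $ j)) + smul (W j i s) (br (x $ j) (x $ i)) = 0" for i j
        using bracket_antisym[OF L, of "x $ i" "x $ j"] x
        by (simp add: sym[of j i] tuples_def flip: scale_right_distrib)
    qed simp
    then show ?thesis
      by (simp add: extension_bracket_def vec_eq_iff)
  qed
  have jacobi: "?E (?E x y) z + ?E (?E y z) x + ?E (?E z x) y = 0"
    if x: "x \<in> tuples V" and y: "y \<in> tuples V" and z: "z \<in> tuples V" for x y z
  proof -
    have "?E (?E x y) z $ t + ?E (?E y z) x $ t + ?E (?E z x) y $ t = 0" for t
    proof -
      define P where "P i j k = (\<Sum>s\<in>UNIV. W i j s * W s k t)" for i j k
      have r: "P j k i = P i j k" for i j k
        unfolding P_def by (rule assoc_comm_tensor_rotate[OF W])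
      \<comment> \<open>Index names stay attached to the vectors: \<open>i\<close> to
        \<open>x\<close>, \<open>j\<close> to \<open>y\<close>, \<open>k\<close> to
        \<open>z\<close>. Rotating the coefficient then gives all three sums the same factor
        \<open>P i j k\<close>.\<close>
      have 2: "?E (?E y z) x $ t =
        (\<Sum>i\<in>UNIV. \<Sum>j\<in>UNIV. \<Sum>k\<in>UNIV. smul (P i j k) (br (br (y $ j) (z $ k)) (x $ i)))"
      proof -
        have "?E (?E y z) x $ t =
          (\<Sum>j\<in>UNIV. \<Sum>k\<in>UNIV. \<Sum>i\<in>UNIV. smul (P j k i) (br (br (y $ j) (z $ k)) (x $ i)))"
          unfolding P_def by (rule extension_bracket_triple[OF L y z x])
        also have "\<dots> =
          (\<Sum>j\<in>UNIV. \<Sum>k\<in>UNIV. \<Sum>i\<in>UNIV. smul (P i j k) (br (br (y $ j) (z $ k)) (x $ i)))"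
          by (intro sum.cong refl arg_cong2[where f=smul]) (rule r)
        also have "\<dots> =
          (\<Sum>j\<in>UNIV. \<Sum>i\<in>UNIV. \<Sum>k\<in>UNIV. smul (P i j k) (br (br (y $ j) (z $ k)) (x $ i)))"
          by (intro sum.cong refl sum.swap)
        also have "\<dots> =
          (\<Sum>i\<in>UNIV. \<Sum>j\<in>UNIV. \<Sum>k\<in>UNIV. smul (P i j k) (br (br (y $ j) (z $ k)) (x $ i)))"
          by (rule sum.swap)
        finally show ?thesis .
      qed
      have 3: "?E (?E z x) y $ t =
        (\<Sum>i\<in>UNIV. \<Sum>j\<in>UNIV. \<Sum>k\<in>UNIV. smul (P i j k) (br (br (z $ k) (x $ i)) (y $ j)))"
      proof -
        have "?E (?E z x) y $ t =
          (\<Sum>k\<in>UNIV. \<Sum>i\<in>UNIV. \<Sum>j\<in>UNIV. smul (P k i j) (br (br (z $ k) (x $ i)) (y $ j)))"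
          unfolding P_def by (rule extension_bracket_triple[OF L z x y])
        also have "\<dots> =
          (\<Sum>k\<in>UNIV. \<Sum>i\<in>UNIV. \<Sum>j\<in>UNIV. smul (P i j k) (br (br (z $ k) (x $ i)) (y $ j)))"
          by (intro sum.cong refl arg_cong2[where f=smul]) (rule r[symmetric])
        also have "\<dots> =
          (\<Sum>i\<in>UNIV. \<Sum>k\<in>UNIV. \<Sum>j\<in>UNIV. smul (P i j k) (br (br (z $ k) (x $ i)) (y $ j)))"
          by (rule sum.swap)
        also have "\<dots> =
          (\<Sum>i\<in>UNIV. \<Sum>j\<in>UNIV. \<Sum>k\<in>UNIV. smul (P i j k) (br (br (z $ k) (x $ i)) (y $ j)))"
          by (intro sum.cong refl sum.swap)
        finally show ?thesis .
      qed
      \<comment> \<open>For fixed \<open>i\<close>, \<open>j\<close>, \<open>k\<close> the common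
        factor multiplies the Jacobi identity of \<open>br\<close>.\<close>
      have J: "br (br (x $ i) (y $ j)) (z $ k) + br (br (y $ j) (z $ k)) (x $ i) +
          br (br (z $ k) (x $ i)) (y $ j) = 0" for i j k
        using L x y z by (simp add: lie_algebra_on_def tuples_def)
      show ?thesis
        unfolding extension_bracket_triple[OF L x y z] 2 3 P_def[symmetric]
        by (simp add: J flip: sum.distrib scale_right_distrib)
    qed
    then show ?thesis
      by (simp add: vec_eq_iff)
  qed
  have E_add: "?E (x + y) z = ?E x z + ?E y z" "?E x (y + z) = ?E x y + ?E x z"
    if "x \<in> tuples V" "y \<in> tuples V" "z \<in> tuples V" for x y z
    using that
    by (simp_all add: extension_bracket_def vec_eq_iff tuples_def add scale_right_distrib sum.distrib)
  have E_scale: "?E (tuple_scale smul c x) y = tuple_scale smul c (?E x y)"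
    "?E x (tuple_scale smul c y) = tuple_scale smul c (?E x y)"
    if "x \<in> tuples V" "y \<in> tuples V" for c x y
    using that
    by (simp_all add: extension_bracket_def tuple_scale_def vec_eq_iff tuples_def scale
        scale_sum_right mult.commute)
  show ?thesis
    unfolding lie_algebra_on_def
    by (simp add: T.vector_space_axioms sub extension_bracket_in_tuples[OF L] E_add E_scale alt jacobi)
qed

section \<open>Necessity, by testing on a two-dimensional Lie algebra\<close>

abbreviation coef :: "(nat \<Rightarrow>\<^sub>0 'k::zero) \<Rightarrow> nat \<Rightarrow> 'k" where
  "coef \<equiv> Poly_Mapping.lookup"

text \<open>Finitely supported sequences multiply by convolution, like polynomials, so scaling is
  multiplication by a constant polynomial.\<close>

definition seq_scale :: "'k::field \<Rightarrow> (nat \<Rightarrow>\<^sub>0 'k) \<Rightarrow> (nat \<Rightarrow>\<^sub>0 'k)" where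
  "seq_scale c p = Poly_Mapping.single 0 c * p"

text \<open>The two-dimensional Lie algebra with \<open>[a, b] = a\<close>, plus an abelian summand that fills up the
  ambient space; here \<open>a\<close> and \<open>b\<close> are the unit sequences at 0 and 1.\<close>

definition affine_bracket :: "(nat \<Rightarrow>\<^sub>0 'k::field) \<Rightarrow> (nat \<Rightarrow>\<^sub>0 'k) \<Rightarrow> (nat \<Rightarrow>\<^sub>0 'k)" where
  "affine_bracket x y = Poly_Mapping.single 0 (coef x 0 * coef y 1 - coef x 1 * coef y 0)"

lemma lookup_seq_scale [simp]: "coef (seq_scale c p) n = c * coef p n"
  by (simp add: seq_scale_def flip: mult_map_scale_conv_mult)
    (simp add: Poly_Mapping.map.rep_eq when_def)

lemma lookup_affine_bracket:
  "coef (affine_bracket x y) n =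
     (if n = 0 then coef x 0 * coef y 1 - coef x 1 * coef y 0 else 0)"
  by (simp add: affine_bracket_def lookup_single when_def)

text \<open>With the whole ambient space as carrier the membership conditions are trivial, and each
  bracket law becomes a polynomial identity in the coordinates 0 and 1.\<close>

lemma lie_algebra_affine: "lie_algebra_on (seq_scale :: 'k::field \<Rightarrow> _) UNIV affine_bracket"
proof -
  have vs: "vector_space (seq_scale :: 'k \<Rightarrow> (nat \<Rightarrow>\<^sub>0 'k) \<Rightarrow> _)"
    by unfold_locales (auto simp: poly_mapping_eq_iff fun_eq_iff lookup_add algebra_simps)
  interpret vector_space "seq_scale :: 'k \<Rightarrow> (nat \<Rightarrow>\<^sub>0 'k) \<Rightarrow> _" by (fact vs)
  show ?thesis
    unfolding lie_algebra_on_def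
    by (auto simp: vs poly_mapping_eq_iff fun_eq_iff lookup_add lookup_affine_bracket algebra_simps)
qed

text \<open>Tuples supported at one index leave a single term of the double sum, which isolates one
  entry of \<open>W\<close>.\<close>

lemma lookup_affine_extension_axis:
  fixes W :: "'n::finite \<Rightarrow> 'n \<Rightarrow> 'n \<Rightarrow> 'k::field"
  shows "coef (extension_bracket W seq_scale affine_bracket (axis i x) (axis j y) $ s) n =
    W i j s * coef (affine_bracket x y) n"
proof -
  have "coef (extension_bracket W seq_scale affine_bracket (axis i x) (axis j y) $ s) n =
    (\<Sum>i'\<in>UNIV. \<Sum>j'\<in>UNIV.
       if j' = j then if i' = i then W i j s * coef (affine_bracket x y) n else 0 else 0)"
    unfolding extension_bracket_def vec_lambda_beta lookup_sum
    by (intro sum.cong refl) (simp add: axis_def lookup_affine_bracket)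
  then show ?thesis by simp
qed

lemma lookup_affine_extension_triple_axis:
  fixes W :: "'n::finite \<Rightarrow> 'n \<Rightarrow> 'n \<Rightarrow> 'k::field"
  defines "E \<equiv> extension_bracket W seq_scale affine_bracket"
  shows "coef (E (E (axis i x) (axis j y)) (axis k z) $ t) n =
    (\<Sum>s\<in>UNIV. W i j s * W s k t) * coef (affine_bracket (affine_bracket x y) z) n"
proof -
  have UNIV_tuple: "x \<in> tuples UNIV" for x :: "(nat \<Rightarrow>\<^sub>0 'k) ^ 'n"
    by (simp add: tuples_def)
  let ?c = "(\<Sum>s\<in>UNIV. W i j s * W s k t) * coef (affine_bracket (affine_bracket x y) z) n"
  have "coef (E (E (axis i x) (axis j y)) (axis k z) $ t) n =
    (\<Sum>i'\<in>UNIV. \<Sum>j'\<in>UNIV. \<Sum>k'\<in>UNIV.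
       if k' = k then if j' = j then if i' = i then ?c else 0 else 0 else 0)"
    unfolding E_def extension_bracket_triple[OF lie_algebra_affine UNIV_tuple UNIV_tuple UNIV_tuple]
      lookup_sum lookup_seq_scale
    by (intro sum.cong refl) (simp add: axis_def lookup_affine_bracket)
  then show ?thesis by simp
qed

lemma assoc_comm_tensor_if_universal:
  fixes W :: "'n::finite \<Rightarrow> 'n \<Rightarrow> 'n \<Rightarrow> 'k::field"
  assumes "universal_extension_tensor W"
  shows "assoc_comm_tensor W"
proof -
  let ?E = "extension_bracket W seq_scale affine_bracket"
  let ?a = "Poly_Mapping.single 0 1 :: nat \<Rightarrow>\<^sub>0 'k" and ?b = "Poly_Mapping.single 1 1 :: nat \<Rightarrow>\<^sub>0 'k"
  have L: "lie_algebra_on (tuple_scale seq_scale) (tuples UNIV) ?E"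
    using assms lie_algebra_affine
    by (auto simp: universal_extension_tensor_def universal_extension_tensor_in_def)
  have sym: "W i j s = W j i s" for i j s
  proof -
    \<comment> \<open>Since \<open>[a, b] = a\<close> and \<open>[b, a] = -a\<close>, the
      coefficient of \<open>a\<close> in component \<open>s\<close> is
      \<open>W i j s - W j i s\<close>.\<close>
    have "?E (axis i ?a) (axis j ?b) + ?E (axis j ?b) (axis i ?a) = 0"
      by (rule bracket_antisym[OF L]) (auto simp: tuples_def)
    then have "coef ((?E (axis i ?a) (axis j ?b) + ?E (axis j ?b) (axis i ?a)) $ s) 0 = 0"
      by simp
    then show ?thesis
      by (simp add: lookup_add lookup_affine_extension_axis lookup_affine_bracket lookup_single)
  qed
  have rot: "(\<Sum>s\<in>UNIV. W i j s * W s k t) = (\<Sum>s\<in>UNIV. W k i s * W s j t)" for i j k t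
  proof -
    \<comment> \<open>The second summand vanishes because \<open>[b, b] = 0\<close>; the other two
      give multiples of \<open>a\<close> with opposite signs, so their coefficients agree.\<close>
    have "?E (?E (axis i ?a) (axis j ?b)) (axis k ?b) + ?E (?E (axis j ?b) (axis k ?b)) (axis i ?a) +
      ?E (?E (axis k ?b) (axis i ?a)) (axis j ?b) = 0"
      using L by (simp add: lie_algebra_on_def tuples_def)
    then have "coef ((?E (?E (axis i ?a) (axis j ?b)) (axis k ?b) +
      ?E (?E (axis j ?b) (axis k ?b)) (axis i ?a) + ?E (?E (axis k ?b) (axis i ?a)) (axis j ?b)) $ t) 0 = 0"
      by simp
    then show ?thesis
      by (simp add: lookup_add lookup_affine_extension_triple_axis lookup_affine_bracket lookup_single)
  qed
  show ?thesis
    unfolding assoc_comm_tensor_def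
  proof (intro conjI allI)
    fix i j k t
    have "(\<Sum>s\<in>UNIV. W i j s * W s k t) = (\<Sum>s\<in>UNIV. W j k s * W s i t)"
      by (rule rot[symmetric])
    also have "\<dots> = (\<Sum>s\<in>UNIV. W j k s * W i s t)"
      by (simp only: sym[of _ i])
    finally show "(\<Sum>s\<in>UNIV. W i j s * W s k t) = (\<Sum>s\<in>UNIV. W j k s * W i s t)" .
  qed (rule sym)
qed

section \<open>Independence of the ambient type, and recovery of the tensor\<close>

text \<open>The type \<open>'g\<close> is arbitrary, so the property tested in one ambient type
  carries over to the Lie algebras in every other.\<close>

lemma universal_extension_tensor_in_if_assoc_comm:
  "assoc_comm_tensor W \<Longrightarrow> universal_extension_tensor_in TYPE('g::ab_group_add) W"
  by (simp add: universal_extension_tensor_in_def lie_algebra_on_extension)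

lemma universal_extension_tensor_iff: "universal_extension_tensor W \<longleftrightarrow> assoc_comm_tensor W"
  using assoc_comm_tensor_if_universal universal_extension_tensor_in_if_assoc_comm
  unfolding universal_extension_tensor_def by blast

text \<open>The single Lie algebra with \<open>[a, b] = a\<close> already recovers every entry of
  \<open>W\<close> from the values on axis tuples.\<close>

lemma inj_universal_extension: "inj universal_extension"
proof (rule injI)
  fix W W' :: "'n::finite \<Rightarrow> 'n \<Rightarrow> 'n \<Rightarrow> 'k::field"
  assume eq: "universal_extension W = universal_extension W'"
  let ?a = "Poly_Mapping.single 0 1 :: nat \<Rightarrow>\<^sub>0 'k" and ?b = "Poly_Mapping.single 1 1 :: nat \<Rightarrow>\<^sub>0 'k"
  \<comment> \<open>The restrictions drop out: the triple is a Lie algebra, and with carrier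
    \<open>UNIV\<close> every tuple is admissible.\<close>
  have ext: "universal_extension U (seq_scale, UNIV, affine_bracket) x y =
      extension_bracket U seq_scale affine_bracket x y" for U :: "'n \<Rightarrow> 'n \<Rightarrow> 'n \<Rightarrow> 'k" and x y
    by (simp add: universal_extension_def lie_algebra_affine tuples_def)
  have "W i j s = W' i j s" for i j s
    using arg_cong[OF eq, where f = "\<lambda>U. coef (U (seq_scale, UNIV, affine_bracket)
        (axis i ?a) (axis j ?b) $ s) 0"]
    by (simp add: ext lookup_affine_extension_axis lookup_affine_bracket lookup_single)
  then show "W = W'"
    by (simp add: fun_eq_iff)
qed

section \<open>Linear maps and coordinates with respect to an indexed basis\<close>

lemma ex1_linear_on_indexed_basis:
  assumes e: "indexed_basis s1 e" and "vector_space s2"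
  shows "\<exists>!f. Vector_Spaces.linear s1 s2 f \<and> (\<forall>i. f (e i) = g i)"
proof -
  interpret finite_dimensional_vector_space s1 "range e"
    using e by (simp add: indexed_basis_def)
  interpret s2: vector_space s2 by fact
  interpret vector_space_pair s1 s2 by unfold_locales
  have "inj e" using e by (simp add: indexed_basis_def)
  \<comment> \<open>\<open>construct\<close> extends a function on basis vectors, so the index is
    first recovered by \<open>inv e\<close>.\<close>
  define f where "f = construct (range e) (g \<circ> inv e)"
  have "Vector_Spaces.linear s1 s2 f"
    unfolding f_def by (rule linear_construct[OF independent_Basis])
  moreover have "f (e i) = g i" for i
    using \<open>inj e\<close> by (simp add: f_def construct_basis[OF independent_Basis])
  ultimately show ?thesis
    by (intro ex1I[of _ f] conjI allI) (auto intro: linear_eq_on_indexed_basis[OF e])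
qed

lemma linear_sum_scale:
  assumes "Vector_Spaces.linear s1 s2 f"
  shows "f (\<Sum>i\<in>I. s1 (c i) (x i)) = (\<Sum>i\<in>I. s2 (c i) (f (x i)))"
proof -
  interpret Vector_Spaces.linear s1 s2 f by fact
  show ?thesis by (simp add: sum scale)
qed

lemma linear_compose_fun:
  assumes "Vector_Spaces.linear s1 s2 f" and "Vector_Spaces.linear s2 s3 g"
  shows "Vector_Spaces.linear s1 s3 (\<lambda>x. g (f x))"
  using assms by (simp add: Vector_Spaces.linear_iff)

lemma ex1_basis_expansion:
  assumes e: "indexed_basis smul e"
  shows "\<exists>!c. x = (\<Sum>i\<in>UNIV. smul (c i) (e i))"
proof -
  interpret finite_dimensional_vector_space smul "range e"
    using e by (simp add: indexed_basis_def)
  have "inj e" using e by (simp add: indexed_basis_def)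
  have "x = (\<Sum>b\<in>range e. smul (representation (range e) x b) b)"
    by (rule sum_representation_eq[symmetric]) (auto simp: independent_Basis span_Basis)
  also have "\<dots> = (\<Sum>i\<in>UNIV. smul (representation (range e) x (e i)) (e i))"
    using \<open>inj e\<close> by (simp add: sum.reindex)
  finally have ex: "\<exists>c. x = (\<Sum>i\<in>UNIV. smul (c i) (e i))"
    by (rule exI[of _ "\<lambda>i. representation (range e) x (e i)"])
  \<comment> \<open>Uniqueness comes from the coordinate functionals: the linear map sending
    \<open>e j\<close> to 1 and the other basis vectors to 0 reads off the coefficient at
    \<open>j\<close>.\<close>
  have coeff: "\<exists>f. \<forall>c. f (\<Sum>i\<in>UNIV. smul (c i) (e i)) = c j" for j
  proof -
    have "vector_space ((*) :: 'a \<Rightarrow> 'a \<Rightarrow> 'a)"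
      by unfold_locales (simp_all add: algebra_simps)
    then obtain f where f: "Vector_Spaces.linear smul (*) f"
      and fe: "\<And>i. f (e i) = (if i = j then 1 else 0)"
      using ex1_linear_on_indexed_basis[OF e, of "(*)" "\<lambda>i. if i = j then 1 else 0"] by blast
    have "f (\<Sum>i\<in>UNIV. smul (c i) (e i)) = c j" for c
      by (simp add: linear_sum_scale[OF f] fe if_distrib[of "\<lambda>u. _ * u"] cong: if_cong)
    then show ?thesis by blast
  qed
  have "c = d" if "x = (\<Sum>i\<in>UNIV. smul (c i) (e i))" "x = (\<Sum>i\<in>UNIV. smul (d i) (e i))" for c d
    using coeff that by (metis ext)
  with ex show ?thesis by blast
qed

lemma basis_expansion_unique:
  assumes "indexed_basis smul e"
    and "(\<Sum>i\<in>UNIV. smul (c i) (e i)) = (\<Sum>i\<in>UNIV. smul (d i) (e i))"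
  shows "c i = d i"
  using ex1_basis_expansion[OF assms(1), of "\<Sum>i\<in>UNIV. smul (c i) (e i)"] assms(2) by metis

section \<open>Structure constants and associative commutative products\<close>

lemma ex1_structure_constants:
  assumes e: "indexed_basis smul e"
  shows "\<exists>!W. structure_constants smul e m W"
proof -
  have "\<forall>i j. \<exists>c. m (e i) (e j) = (\<Sum>s\<in>UNIV. smul (c s) (e s))"
    using ex1_basis_expansion[OF e] by blast
  then obtain W where "\<forall>i j. m (e i) (e j) = (\<Sum>s\<in>UNIV. smul (W i j s) (e s))"
    by metis
  moreover have "W1 = W2"
    if "structure_constants smul e m W1" "structure_constants smul e m W2" for W1 W2
    using that basis_expansion_unique[OF e, of "W1 i j" "W2 i j" for i j]
    by (simp add: structure_constants_def fun_eq_iff)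
  ultimately show ?thesis
    by (auto simp: structure_constants_def)
qed

lemma algebra_product_unique:
  assumes "indexed_basis smul e" and "bilinear_product smul m" and "structure_constants smul e m W"
  shows "algebra_product smul e W = m"
  using ex1_bilinear_product[OF assms(1), of W] algebra_product[OF assms(1), of W] assms(2,3) by blast

lemma bilinear_product_linear:
  assumes "bilinear_product smul m"
  shows "Vector_Spaces.linear smul smul (\<lambda>y. m x y)" and "Vector_Spaces.linear smul smul (\<lambda>x. m x y)"
  using assms by (simp_all add: bilinear_product_def)

text \<open>Both laws are equations between maps linear in each argument, so they hold everywhere
  once they hold on basis vectors, where they compare coefficients.\<close>

lemma assoc_comm_product_iff:
  assumes e: "indexed_basis smul e" and m: "bilinear_product smul m"
    and W: "structure_constants smul e m W"
  shows "assoc_comm_product smul m \<longleftrightarrow> assoc_comm_tensor W"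
proof -
  note lin = bilinear_product_linear[OF m]
  have mW: "m (e i) (e j) = (\<Sum>s\<in>UNIV. smul (W i j s) (e s))" for i j
    using W by (simp add: structure_constants_def)
  interpret finite_dimensional_vector_space smul "range e"
    using e by (simp add: indexed_basis_def)
  have comm: "(\<forall>x y. m x y = m y x) \<longleftrightarrow> (\<forall>i j s. W i j s = W j i s)"
  proof
    assume "\<forall>x y. m x y = m y x"
    then have "(\<Sum>s\<in>UNIV. smul (W i j s) (e s)) = (\<Sum>s\<in>UNIV. smul (W j i s) (e s))" for i j
      by (metis mW)
    then show "\<forall>i j s. W i j s = W j i s"
      using basis_expansion_unique[OF e] by blast
  next
    assume "\<forall>i j s. W i j s = W j i s"
    then have "m (e i) (e j) = m (e j) (e i)" for i j
      by (simp add: mW)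
    \<comment> \<open>One basis vector at a time is replaced by an arbitrary vector, using linearity
      in that slot.\<close>
    then have "(\<lambda>x. m x (e j)) = (\<lambda>x. m (e j) x)" for j
      by (intro linear_eq_on_indexed_basis[OF e lin(2) lin(1)])
    then have "(\<lambda>y. m x y) = (\<lambda>y. m y x)" for x
      by (intro linear_eq_on_indexed_basis[OF e lin(1) lin(2)]) (metis fun_cong)
    then show "\<forall>x y. m x y = m y x"
      by (metis fun_cong)
  qed
  \<comment> \<open>\<open>left\<close> and \<open>right\<close> identify the two sums in
    \<open>assoc_comm_tensor\<close> as the coordinates of the two bracketings of a triple
    product.\<close>
  have left: "m (m (e i) (e j)) (e k) = (\<Sum>t\<in>UNIV. smul (\<Sum>s\<in>UNIV. W i j s * W s k t) (e t))"
    for i j k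
    unfolding mW[of i j] linear_sum_scale[OF lin(2)] mW
    by (simp add: scale_sum_right scale_sum_left) (rule sum.swap)
  have right: "m (e i) (m (e j) (e k)) = (\<Sum>t\<in>UNIV. smul (\<Sum>s\<in>UNIV. W j k s * W i s t) (e t))"
    for i j k
    unfolding mW[of j k] linear_sum_scale[OF lin(1)] mW
    by (simp add: scale_sum_right scale_sum_left) (rule sum.swap)
  have assoc: "(\<forall>x y z. m (m x y) z = m x (m y z)) \<longleftrightarrow>
    (\<forall>i j k t. (\<Sum>s\<in>UNIV. W i j s * W s k t) = (\<Sum>s\<in>UNIV. W j k s * W i s t))"
  proof
    assume "\<forall>x y z. m (m x y) z = m x (m y z)"
    then have "(\<Sum>t\<in>UNIV. smul (\<Sum>s\<in>UNIV. W i j s * W s k t) (e t)) =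
        (\<Sum>t\<in>UNIV. smul (\<Sum>s\<in>UNIV. W j k s * W i s t) (e t))" for i j k
      by (metis left right)
    from basis_expansion_unique[OF e this]
    show "\<forall>i j k t. (\<Sum>s\<in>UNIV. W i j s * W s k t) = (\<Sum>s\<in>UNIV. W j k s * W i s t)"
      by blast
  next
    assume "\<forall>i j k t. (\<Sum>s\<in>UNIV. W i j s * W s k t) = (\<Sum>s\<in>UNIV. W j k s * W i s t)"
    then have "m (m (e i) (e j)) (e k) = m (e i) (m (e j) (e k))" for i j k
      by (simp add: left right)
    then have "(\<lambda>x. m (m x (e j)) (e k)) = (\<lambda>x. m x (m (e j) (e k)))" for j k
      by (intro linear_eq_on_indexed_basis[OF e linear_compose_fun[OF lin(2) lin(2)] lin(2)])
    then have "(\<lambda>y. m (m x y) (e k)) = (\<lambda>y. m x (m y (e k)))" for x k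
      by (intro linear_eq_on_indexed_basis[OF e linear_compose_fun[OF lin(1) lin(2)]
          linear_compose_fun[OF lin(2) lin(1)]]) (metis fun_cong)
    then have "(\<lambda>z. m (m x y) z) = (\<lambda>z. m x (m y z))" for x y
      by (intro linear_eq_on_indexed_basis[OF e lin(1) linear_compose_fun[OF lin(1) lin(1)]])
        (metis fun_cong)
    then show "\<forall>x y z. m (m x y) z = m x (m y z)"
      by (metis fun_cong)
  qed
  show ?thesis
    unfolding assoc_comm_product_def assoc_comm_tensor_def comm assoc using m by blast
qed

text \<open>Injective because a product determines its structure constants; surjective because a
  bilinear product is rebuilt from them.\<close>

lemma bij_betw_algebra_product:
  assumes e: "indexed_basis smul e"
  shows "bij_betw (algebra_product smul e) {W. assoc_comm_tensor W} {m. assoc_comm_product smul m}"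
  unfolding bij_betw_def
proof (intro conjI set_eqI iffI)
  show "inj_on (algebra_product smul e) {W. assoc_comm_tensor W}"
    using algebra_product(2)[OF e] ex1_structure_constants[OF e] by (metis inj_onI)
next
  fix m assume "m \<in> algebra_product smul e ` {W. assoc_comm_tensor W}"
  then show "m \<in> {m. assoc_comm_product smul m}"
    using assoc_comm_product_iff[OF e algebra_product[OF e]] by blast
next
  fix m assume "m \<in> {m. assoc_comm_product smul m}"
  then have ac: "assoc_comm_product smul m" and m: "bilinear_product smul m"
    unfolding assoc_comm_product_def by blast+
  obtain W where W: "structure_constants smul e m W"
    using ex1_structure_constants[OF e] by blast
  have "m = algebra_product smul e W"
    using algebra_product_unique[OF e m W] by simp
  then show "m \<in> algebra_product smul e ` {W. assoc_comm_tensor W}"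
    using assoc_comm_product_iff[OF e m W] ac by blast
qed

section \<open>The representation by multiplication matrices\<close>

lemma vector_space_matrix_scale: "vector_space (matrix_scale :: 'k::field \<Rightarrow> 'k ^ 'n ^ 'm \<Rightarrow> _)"
  by unfold_locales (simp_all add: matrix_scale_def vec_eq_iff algebra_simps)

lemma linear_matrix_mult:
  fixes M :: "'k::field ^ 'n ^ 'm"
  shows "Vector_Spaces.linear matrix_scale matrix_scale (\<lambda>N :: 'k ^ 'p ^ 'n. M ** N)"
    and "Vector_Spaces.linear matrix_scale matrix_scale (\<lambda>L :: 'k ^ 'm ^ 'q. L ** M)"
  by (simp_all add: Vector_Spaces.linear_iff vector_space_matrix_scale matrix_scale_def
      matrix_matrix_mult_def vec_eq_iff sum_distrib_left sum.distrib algebra_simps)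

text \<open>In row \<open>k\<close> and column \<open>l\<close> this is e^i * (e^j * e^l) = (e^i *
  e^j) * e^l, read off at e^k.\<close>

lemma tensor_matrix_mult:
  assumes "assoc_comm_tensor W"
  shows "tensor_matrix W i ** tensor_matrix W j = (\<Sum>s\<in>UNIV. matrix_scale (W i j s) (tensor_matrix W s))"
  using assms
  by (simp add: tensor_matrix_def matrix_scale_def matrix_matrix_mult_def vec_eq_iff
      assoc_comm_tensor_def mult.commute)

text \<open>Multiplicativity on pairs of basis vectors is \<open>tensor_matrix_mult\<close>; both
  sides are linear in each argument, so it extends one argument at a time.\<close>

lemma matrix_representation_tensor_matrix:
  assumes e: "indexed_basis smul e" and W: "assoc_comm_tensor W"
    and \<Phi>: "Vector_Spaces.linear smul matrix_scale \<Phi>" and \<Phi>_e: "\<And>i. \<Phi> (e i) = tensor_matrix W i"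
  shows "matrix_representation smul (algebra_product smul e W) \<Phi>"
proof -
  let ?m = "algebra_product smul e W"
  note lin = bilinear_product_linear[OF algebra_product(1)[OF e, of W]]
  have "\<Phi> (?m (e i) (e j)) = \<Phi> (e i) ** \<Phi> (e j)" for i j
    using algebra_product(2)[OF e, of W]
    by (simp add: structure_constants_def linear_sum_scale[OF \<Phi>] \<Phi>_e tensor_matrix_mult[OF W])
  then have "(\<lambda>x. \<Phi> (?m x (e j))) = (\<lambda>x. \<Phi> x ** \<Phi> (e j))" for j
    by (intro linear_eq_on_indexed_basis[OF e linear_compose_fun[OF lin(2) \<Phi>]
        linear_compose_fun[OF \<Phi> linear_matrix_mult(2)]])
  then have "(\<lambda>y. \<Phi> (?m x y)) = (\<lambda>y. \<Phi> x ** \<Phi> y)" for x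
    by (intro linear_eq_on_indexed_basis[OF e linear_compose_fun[OF lin(1) \<Phi>]
        linear_compose_fun[OF \<Phi> linear_matrix_mult(1)]]) (metis fun_cong)
  then show ?thesis
    using \<Phi> by (auto simp: matrix_representation_def dest: fun_cong)
qed

section \<open>Change of basis\<close>

lemma matrix_inv_mult:
  assumes "invertible A"
  shows "A ** matrix_inv A = mat 1" and "matrix_inv A ** A = mat 1"
  using someI_ex[OF assms[unfolded invertible_def]] by (simp_all add: matrix_inv_def)

text \<open>Inserting the new vectors produces the entries of \<open>A ** matrix_inv A\<close>,
  which is the identity.\<close>

lemma old_basis_eq:
  assumes "vector_space smul" and A: "invertible A"
  shows "e k = (\<Sum>k'\<in>UNIV. smul (matrix_inv A $ k' $ k) (change_basis smul A e k'))"
proof -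
  interpret vector_space smul by fact
  have "(\<Sum>k'\<in>UNIV. smul (matrix_inv A $ k' $ k) (change_basis smul A e k')) =
    (\<Sum>k'\<in>UNIV. \<Sum>i\<in>UNIV. smul (A $ i $ k' * matrix_inv A $ k' $ k) (e i))"
    by (simp add: change_basis_def scale_sum_right mult.commute)
  also have "\<dots> = (\<Sum>i\<in>UNIV. smul ((A ** matrix_inv A) $ i $ k) (e i))"
    by (subst sum.swap) (simp add: matrix_matrix_mult_def scale_sum_left)
  also have "\<dots> = (\<Sum>i\<in>UNIV. if i = k then e i else 0)"
    by (intro sum.cong) (auto simp: matrix_inv_mult[OF A] mat_def)
  finally show ?thesis by simp
qed

text \<open>The new vectors span because the old ones are combinations of them; counting against the
  dimension then gives independence and injectivity.\<close>

lemma indexed_basis_change_basis: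
  fixes e :: "'n::finite \<Rightarrow> 'a::ab_group_add"
  assumes e: "indexed_basis smul e" and A: "invertible A"
  shows "indexed_basis smul (change_basis smul A e)"
proof -
  let ?f = "change_basis smul A e"
  interpret finite_dimensional_vector_space smul "range e"
    using e by (simp add: indexed_basis_def)
  have "e k \<in> span (range ?f)" for k
    by (subst old_basis_eq[OF vector_space_axioms A]) (intro span_sum span_scale span_base rangeI)
  then have "span (range e) \<subseteq> span (range ?f)"
    by (intro span_minimal) auto
  then have sp: "span (range ?f) = UNIV"
    by (auto simp: span_Basis)
  have "inj e" using e by (simp add: indexed_basis_def)
  then have dim: "dim UNIV = card (UNIV :: 'n set)"
    by (simp add: dim_UNIV dimension_def card_image)
  \<comment> \<open>Only an inequality is available before injectivity. It yields independence,
    which makes it an equality and so forces \<open>?f\<close> to be injective.\<close>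
  have "card (range ?f) \<le> dim UNIV"
    unfolding dim by (rule card_image_le) simp
  then have ind: "independent (range ?f)"
    using sp by (intro card_le_dim_spanning[of _ UNIV]) auto
  have "card (range ?f) = card (UNIV :: 'n set)"
    using basis_card_eq_dim[of "range ?f" UNIV] ind sp dim by simp
  then have "inj ?f"
    by (intro eq_card_imp_inj_on) auto
  with ind sp show ?thesis
    unfolding indexed_basis_def by (intro conjI) (unfold_locales, auto)
qed

text \<open>The product of two new basis vectors is expanded in the old basis, rewritten in the new
  one, and compared coefficientwise.\<close>

lemma structure_constants_change_basis:
  assumes e: "indexed_basis smul e" and A: "invertible A"
    and m: "bilinear_product smul m" and W: "structure_constants smul e m W"
    and W': "structure_constants smul (change_basis smul A e) m W'"
  shows "W' i' j' k' = (\<Sum>i\<in>UNIV. \<Sum>j\<in>UNIV. \<Sum>k\<in>UNIV.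
    A $ i $ i' * A $ j $ j' * matrix_inv A $ k' $ k * W i j k)"
proof -
  let ?f = "change_basis smul A e"
  let ?c = "\<lambda>k'. \<Sum>i\<in>UNIV. \<Sum>j\<in>UNIV. \<Sum>k\<in>UNIV.
    A $ i $ i' * A $ j $ j' * matrix_inv A $ k' $ k * W i j k"
  interpret finite_dimensional_vector_space smul "range e"
    using e by (simp add: indexed_basis_def)
  note lin = bilinear_product_linear[OF m]
  have mW: "m (e i) (e j) = (\<Sum>s\<in>UNIV. smul (W i j s) (e s))" for i j
    using W by (simp add: structure_constants_def)
  have "(\<Sum>k'\<in>UNIV. smul (W' i' j' k') (?f k')) = m (?f i') (?f j')"
    using W' by (simp add: structure_constants_def)
  also have "\<dots> = (\<Sum>i\<in>UNIV. smul (A $ i $ i') (\<Sum>j\<in>UNIV. smul (A $ j $ j') (m (e i) (e j))))"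
    unfolding change_basis_def linear_sum_scale[OF lin(2)] unfolding linear_sum_scale[OF lin(1)]
    by (rule refl)
  also have "\<dots> = (\<Sum>i\<in>UNIV. \<Sum>j\<in>UNIV. \<Sum>k\<in>UNIV. smul (A $ i $ i' * A $ j $ j' * W i j k) (e k))"
    by (simp add: mW scale_sum_right mult.assoc)
  \<comment> \<open>The return to the new basis is where the inverse matrix enters; the exchanges
    that follow move \<open>k'\<close> outermost.\<close>
  also have "\<dots> = (\<Sum>i\<in>UNIV. \<Sum>j\<in>UNIV. \<Sum>k\<in>UNIV. \<Sum>k'\<in>UNIV.
      smul (A $ i $ i' * A $ j $ j' * matrix_inv A $ k' $ k * W i j k) (?f k'))"
    by (subst old_basis_eq[OF vector_space_axioms A, of e]) (simp add: scale_sum_right mult_ac)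
  also have "\<dots> = (\<Sum>i\<in>UNIV. \<Sum>j\<in>UNIV. \<Sum>k'\<in>UNIV. \<Sum>k\<in>UNIV.
      smul (A $ i $ i' * A $ j $ j' * matrix_inv A $ k' $ k * W i j k) (?f k'))"
    by (intro sum.cong refl sum.swap)
  also have "\<dots> = (\<Sum>i\<in>UNIV. \<Sum>k'\<in>UNIV. \<Sum>j\<in>UNIV. \<Sum>k\<in>UNIV.
      smul (A $ i $ i' * A $ j $ j' * matrix_inv A $ k' $ k * W i j k) (?f k'))"
    by (intro sum.cong refl sum.swap)
  also have "\<dots> = (\<Sum>k'\<in>UNIV. \<Sum>i\<in>UNIV. \<Sum>j\<in>UNIV. \<Sum>k\<in>UNIV.
      smul (A $ i $ i' * A $ j $ j' * matrix_inv A $ k' $ k * W i j k) (?f k'))"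
    by (rule sum.swap)
  also have "\<dots> = (\<Sum>k'\<in>UNIV. smul (?c k') (?f k'))"
    by (simp add: scale_sum_left)
  finally show ?thesis
    by (rule basis_expansion_unique[OF indexed_basis_change_basis[OF e A]])
qed

text \<open>The sum over \<open>k\<close> is left multiplication by \<open>matrix_inv A\<close>, the
  sum over \<open>j\<close> is right multiplication by \<open>A\<close>, and
  \<open>A $ i $ i'\<close> stays outside as a scalar.\<close>

lemma tensor_matrix_change_basis:
  assumes W': "\<And>j' k'. W' i' j' k' = (\<Sum>i\<in>UNIV. \<Sum>j\<in>UNIV. \<Sum>k\<in>UNIV.
      A $ i $ i' * A $ j $ j' * matrix_inv A $ k' $ k * W i j k)"
  shows "tensor_matrix W' i' =
    (\<Sum>i\<in>UNIV. matrix_scale (A $ i $ i') (matrix_inv A ** tensor_matrix W i ** A))"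
proof -
  have "W' i' j' k' = (\<Sum>i\<in>UNIV. A $ i $ i' *
      (\<Sum>j\<in>UNIV. (\<Sum>k\<in>UNIV. matrix_inv A $ k' $ k * W i j k) * A $ j $ j'))" for j' k'
    unfolding W' sum_distrib_left sum_distrib_right by (intro sum.cong refl) (simp only: mult_ac)
  then show ?thesis
    by (simp add: vec_eq_iff tensor_matrix_def matrix_scale_def matrix_matrix_mult_def)
qed

theorem theorem2p1:
  fixes smul :: "'k::field \<Rightarrow> 'a::ab_group_add \<Rightarrow> 'a" and e :: "'n::finite \<Rightarrow> 'a"
  assumes "indexed_basis smul e"
  shows
    "(\<forall>W :: 'n \<Rightarrow> 'n \<Rightarrow> 'n \<Rightarrow> 'k. universal_extension_tensor W \<longrightarrow>
        universal_extension_tensor_in TYPE('g::ab_group_add) W) \<and>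
     inj_on universal_extension {W :: 'n \<Rightarrow> 'n \<Rightarrow> 'n \<Rightarrow> 'k. universal_extension_tensor W} \<and>
     bij_betw (algebra_product smul e)
       {W. universal_extension_tensor W} {m. assoc_comm_product smul m} \<and>
     (\<forall>W. universal_extension_tensor W \<longrightarrow>
        (\<exists>!\<Phi>. Vector_Spaces.linear smul matrix_scale \<Phi> \<and> (\<forall>i. \<Phi> (e i) = tensor_matrix W i)) \<and>
        (\<forall>\<Phi>. Vector_Spaces.linear smul matrix_scale \<Phi> \<and> (\<forall>i. \<Phi> (e i) = tensor_matrix W i) \<longrightarrow>
             matrix_representation smul (algebra_product smul e W) \<Phi>) \<and>
        (\<forall>A :: 'k ^ 'n ^ 'n. invertible A \<longrightarrow>
           indexed_basis smul (change_basis smul A e) \<and>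
           (\<exists>!W'. structure_constants smul (change_basis smul A e) (algebra_product smul e W) W') \<and>
           (\<forall>W'. structure_constants smul (change_basis smul A e) (algebra_product smul e W) W' \<longrightarrow>
              (\<forall>i' j' k'. W' i' j' k' =
                 (\<Sum>i\<in>UNIV. \<Sum>j\<in>UNIV. \<Sum>k\<in>UNIV.
                    A $ i $ i' * A $ j $ j' * matrix_inv A $ k' $ k * W i j k)) \<and>
              (\<forall>i'. tensor_matrix W' i' =
                 (\<Sum>i\<in>UNIV. matrix_scale (A $ i $ i') (matrix_inv A ** tensor_matrix W i ** A))))))"
\<comment> \<open>Injectivity of \<open>universal_extension\<close> on all families restricts to the
  tensors, which settles that conjunct here.\<close>
proof (intro conjI allI impI inj_on_subset[OF inj_universal_extension subset_UNIV])
  show "universal_extension_tensor_in TYPE('g) W" if "universal_extension_tensor W"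
    for W :: "'n \<Rightarrow> 'n \<Rightarrow> 'n \<Rightarrow> 'k"
    using that by (simp add: universal_extension_tensor_iff universal_extension_tensor_in_if_assoc_comm)
  show "bij_betw (algebra_product smul e) {W. universal_extension_tensor W} {m. assoc_comm_product smul m}"
    by (simp add: universal_extension_tensor_iff bij_betw_algebra_product[OF assms])
next
  fix W :: "'n \<Rightarrow> 'n \<Rightarrow> 'n \<Rightarrow> 'k"
  assume "universal_extension_tensor W"
  then have W: "assoc_comm_tensor W"
    by (simp add: universal_extension_tensor_iff)
  note m = algebra_product[OF assms, of W]
  show "\<exists>!\<Phi>. Vector_Spaces.linear smul matrix_scale \<Phi> \<and> (\<forall>i. \<Phi> (e i) = tensor_matrix W i)"
    by (rule ex1_linear_on_indexed_basis[OF assms vector_space_matrix_scale])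
  show "matrix_representation smul (algebra_product smul e W) \<Phi>"
    if "Vector_Spaces.linear smul matrix_scale \<Phi> \<and> (\<forall>i. \<Phi> (e i) = tensor_matrix W i)" for \<Phi>
    using that by (blast intro: matrix_representation_tensor_matrix[OF assms W])
  fix A :: "'k ^ 'n ^ 'n"
  assume A: "invertible A"
  show "indexed_basis smul (change_basis smul A e)"
    by (rule indexed_basis_change_basis[OF assms A])
  then show "\<exists>!W'. structure_constants smul (change_basis smul A e) (algebra_product smul e W) W'"
    by (rule ex1_structure_constants)
  fix W'
  assume "structure_constants smul (change_basis smul A e) (algebra_product smul e W) W'"
  note eq = structure_constants_change_basis[OF assms A m this]
  show "W' i' j' k' = (\<Sum>i\<in>UNIV. \<Sum>j\<in>UNIV. \<Sum>k\<in>UNIV.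
      A $ i $ i' * A $ j $ j' * matrix_inv A $ k' $ k * W i j k)" for i' j' k'
    by (rule eq)
  show "tensor_matrix W' i' =
      (\<Sum>i\<in>UNIV. matrix_scale (A $ i $ i') (matrix_inv A ** tensor_matrix W i ** A))" for i'
    by (rule tensor_matrix_change_basis) (rule eq)
qed

end
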